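(* Let $d\ge1$ and let $SPN$ be the set of symplectic matrices $H\in\mathbb{R}^{2d\times 2d}$ whose left upper $d\times d$ block is nonsingular. Then $SPN\subsetneq\mathcal{L}_{8}$. Thus any symplectic matrix with nonsingular left upper block can be factored into no more than $8$ unit triangular symplectic matrices.
   Context: Let $I=I_d$ and $J=\begin{bmatrix} 0 & I_{d} \\ -I_{d} & 0 \end{bmatrix}$. A real $2d\times 2d$ matrix $H$ is symplectic if $H^{T}JH=J$. The unit triangular symplectic matrices are those of the form $\begin{bmatrix} I & S \\ 0 & I\end{bmatrix}$ (upper) or $\begin{bmatrix} I & 0 \\ S & I\end{bmatrix}$ (lower) with $S\in\mathbb{R}^{d\times d}$ symmetric. For $n\ge1$, $\mathcal{L}_{n}$ is the set of all products $M_n\cdots M_2M_1$ where $M_i=\begin{bmatrix} I & S_i \\ 0 & I\end{bmatrix}$ for $i$ odd and $M_i=\begin{bmatrix} I & 0 \\ S_i & I\end{bmatrix}$ for $i$ even, with $S_1,\dots,S_n\in\mathbb{R}^{d\times d}$ arbitrary symmetric matrices. The symbol $\subsetneq$ denotes proper inclusion. *)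

theory Defs
  imports "Jordan_Normal_Form.Matrix" Complex_Main
begin

definition symplectic_form :: "nat \<Rightarrow> real mat" where
  "symplectic_form d = four_block_mat (0\<^sub>m d d) (1\<^sub>m d) (- 1\<^sub>m d) (0\<^sub>m d d)"

definition symplectic :: "nat \<Rightarrow> real mat \<Rightarrow> bool" where
  "symplectic d H \<longleftrightarrow>
     H \<in> carrier_mat (2 * d) (2 * d) \<and>
     transpose_mat H * symplectic_form d * H = symplectic_form d"

definition symmetric_mats :: "nat \<Rightarrow> real mat set" where
  "symmetric_mats d = {S \<in> carrier_mat d d. transpose_mat S = S}"

definition upper_unit :: "nat \<Rightarrow> real mat \<Rightarrow> real mat" where
  "upper_unit d S = four_block_mat (1\<^sub>m d) S (0\<^sub>m d d) (1\<^sub>m d)"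

definition lower_unit :: "nat \<Rightarrow> real mat \<Rightarrow> real mat" where
  "lower_unit d S = four_block_mat (1\<^sub>m d) (0\<^sub>m d d) S (1\<^sub>m d)"

definition unit_triangular_symplectic :: "nat \<Rightarrow> real mat set" where
  "unit_triangular_symplectic d =
     upper_unit d ` symmetric_mats d \<union> lower_unit d ` symmetric_mats d"

definition alternating_factor :: "nat \<Rightarrow> (nat \<Rightarrow> real mat) \<Rightarrow> nat \<Rightarrow> real mat" where
  "alternating_factor d S i = (if odd i then upper_unit d (S i) else lower_unit d (S i))"

text \<open>Later factors are multiplied on the left, so for \<open>n \<ge> 1\<close> this is
  \<open>M\<^sub>n \<cdots> M\<^sub>2 M\<^sub>1\<close> with \<open>M\<^sub>i = alternating_factor d S i\<close>.\<close>

fun alternating_product :: "nat \<Rightarrow> (nat \<Rightarrow> real mat) \<Rightarrow> nat \<Rightarrow> real mat" where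
  "alternating_product d S 0 = 1\<^sub>m (2 * d)"
| "alternating_product d S (Suc n) =
     alternating_factor d S (Suc n) * alternating_product d S n"

definition L_set :: "nat \<Rightarrow> nat \<Rightarrow> real mat set" where
  "L_set d n = {alternating_product d S n | S. \<forall>i\<in>{1..n}. S i \<in> symmetric_mats d}"

definition left_upper_block :: "nat \<Rightarrow> real mat \<Rightarrow> real mat" where
  "left_upper_block d H = mat d d (\<lambda>(i, j). H $$ (i, j))"

definition SPN :: "nat \<Rightarrow> real mat set" where
  "SPN d = {H. symplectic d H \<and> invertible_mat (left_upper_block d H)}"

end

theory Submission
  imports Defs "Jordan_Normal_Form.Char_Poly"
begin

text \<open>Write \<open>H = [[A, B], [C, D]]\<close> with \<open>A\<close> nonsingular. If \<open>A\<close> is a product \<open>P Q\<^sup>-\<^sup>1\<close> of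
  nonsingular symmetric matrices, then six factors suffice. By Frobenius this is always so, but
  two spare factors make it possible to avoid that theorem: they replace \<open>A\<close> by \<open>G A\<close> for any
  nonsingular \<open>G\<close> with \<open>G - 1\<close> a product \<open>S T\<close> of symmetric matrices, because
  \<open>C A\<^sup>-\<^sup>1\<close> is symmetric. So it is enough to find a nonsingular \<open>G\<close> such that \<open>G\<close> and \<open>G A\<close> are
  both products of two symmetric matrices. Up to similarity \<open>A\<close> has a nonzero pivot, and
  Gaussian elimination produces such a \<open>G\<close>: by induction, both matrices become block triangular
  with generic diagonal entries.\<close>

section \<open>Matrix algebra and symmetric matrices\<close>

lemma symmetric_mats_carrier: "S \<in> symmetric_mats d \<Longrightarrow> S \<in> carrier_mat d d"
  by (simp add: symmetric_mats_def)

lemma symmetric_mats_transpose: "S \<in> symmetric_mats d \<Longrightarrow> transpose_mat S = S"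
  by (simp add: symmetric_mats_def)

text \<open>Here and in the next lemmas the side conditions are equations between dimensions instead
  of carrier memberships, so that simp can use the laws as rewrite rules once the
  \<open>carrier_matD\<close> facts are declared.\<close>

lemma mult_assoc_dim:
  fixes A :: "'a :: semiring_0 mat"
  assumes "dim_col A = dim_row B" "dim_col B = dim_row C"
  shows "A * B * C = A * (B * C)"
  by (rule assoc_mult_mat) (use assms in \<open>auto intro!: carrier_matI\<close>)

lemma mult_add_dim:
  fixes A :: "'a :: semiring_0 mat"
  assumes "dim_col A = dim_row B" "dim_row C = dim_row B" "dim_col C = dim_col B"
  shows "A * (B + C) = A * B + A * C"
  by (rule mult_add_distrib_mat) (use assms in \<open>auto intro!: carrier_matI\<close>)

lemma add_mult_dim:
  fixes A :: "'a :: semiring_0 mat"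
  assumes "dim_col B = dim_row A" "dim_row C = dim_row B" "dim_col C = dim_col B"
  shows "(B + C) * A = B * A + C * A"
  by (rule add_mult_distrib_mat) (use assms in \<open>auto intro!: carrier_matI\<close>)

lemma mult_minus_dim:
  fixes A :: "'a :: ring mat"
  assumes "dim_col A = dim_row B" "dim_row C = dim_row B" "dim_col C = dim_col B"
  shows "A * (B - C) = A * B - A * C"
  by (rule mult_minus_distrib_mat) (use assms in \<open>auto intro!: carrier_matI\<close>)

lemma minus_mult_dim:
  fixes A :: "'a :: ring mat"
  assumes "dim_col B = dim_row A" "dim_row C = dim_row B" "dim_col C = dim_col B"
  shows "(B - C) * A = B * A - C * A"
  by (rule minus_mult_distrib_mat) (use assms in \<open>auto intro!: carrier_matI\<close>)

lemma transpose_mult_dim: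
  fixes A :: "'a :: comm_semiring_0 mat"
  assumes "dim_col A = dim_row B"
  shows "transpose_mat (A * B) = transpose_mat B * transpose_mat A"
  by (rule transpose_mult) (use assms in \<open>auto intro!: carrier_matI\<close>)

lemma transpose_minus_dim:
  assumes "dim_row A = dim_row B" "dim_col A = dim_col B"
  shows "transpose_mat (A - B) = transpose_mat A - transpose_mat B"
  by (rule eq_matI) (use assms in auto)

text \<open>The right-nested form is the one that \<open>mult_assoc_dim\<close> leaves behind, so
  the two together cancel inverses inside long products.\<close>

lemma mult_cancel_inverse:
  fixes A :: "'a :: semiring_1 mat"
  assumes "A * B = 1\<^sub>m n" "dim_col A = dim_row B" "dim_row C = n" "dim_col B = n"
  shows "A * (B * C) = C"
proof -
  have "A * (B * C) = A * B * C"
    by (rule mult_assoc_dim[symmetric]) (use assms in auto)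
  also have "\<dots> = C"
    using assms by (auto intro: left_mult_one_mat carrier_matI)
  finally show ?thesis .
qed

lemma det_nonzero_inverse:
  fixes A :: "'a :: field mat"
  assumes A: "A \<in> carrier_mat n n" and "det A \<noteq> 0"
  obtains B where "B \<in> carrier_mat n n" "A * B = 1\<^sub>m n" "B * A = 1\<^sub>m n"
  using det_non_zero_imp_unit[OF assms, of undefined]
  unfolding Units_def ring_mat_def by auto

lemma inverse_det_nonzero:
  fixes A :: "'a :: field mat"
  assumes "A \<in> carrier_mat n n" "B \<in> carrier_mat n n" "A * B = 1\<^sub>m n"
  shows "det A \<noteq> 0"
  using det_mult[OF assms(1,2)] assms(3) by auto

text \<open>Transposing \<open>Q * R = 1\<close> makes the transpose of \<open>R\<close> a left
  inverse of \<open>Q\<close>, and it must agree with the right inverse \<open>R\<close>.\<close>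

lemma symmetric_mats_inverse:
  assumes Q: "Q \<in> symmetric_mats n" and R: "R \<in> carrier_mat n n"
    and QR: "Q * R = 1\<^sub>m n" and RQ: "R * Q = 1\<^sub>m n"
  shows "R \<in> symmetric_mats n"
proof -
  have Qc: "Q \<in> carrier_mat n n" and Qt: "transpose_mat Q = Q"
    using Q by (auto simp: symmetric_mats_def)
  have *: "transpose_mat R * Q = 1\<^sub>m n"
    using arg_cong[OF QR, of transpose_mat] Qc R Qt by (simp add: transpose_mult_dim)
  have "transpose_mat R = transpose_mat R * (Q * R)"
    using R QR by simp
  also have "\<dots> = R"
    using mult_cancel_inverse[OF *, of R] Qc R by simp
  finally show ?thesis using R by (simp add: symmetric_mats_def)
qed

lemma symmetric_mats_minus:
  "S \<in> symmetric_mats n \<Longrightarrow> T \<in> symmetric_mats n \<Longrightarrow> S - T \<in> symmetric_mats n"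
  by (auto simp: symmetric_mats_def transpose_minus_dim)

lemma symmetric_mats_uminus:
  "S \<in> symmetric_mats n \<Longrightarrow> - S \<in> symmetric_mats n"
  by (auto simp: symmetric_mats_def transpose_uminus)

lemma symmetric_mats_congruence:
  assumes S: "S \<in> symmetric_mats n" and V: "V \<in> carrier_mat m n"
  shows "V * S * transpose_mat V \<in> symmetric_mats m"
  using assms by (auto simp: symmetric_mats_def transpose_mult_dim mult_assoc_dim)

section \<open>Symmetrizable matrices and their closure properties\<close>

text \<open>Equivalently, \<open>X = (X Q) Q\<^sup>-\<^sup>1\<close> is a product of two symmetric matrices, the second
  one nonsingular.\<close>

definition symmetrizable :: "nat \<Rightarrow> real mat \<Rightarrow> bool" where
  "symmetrizable n X \<longleftrightarrow> X \<in> carrier_mat n n \<and>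
     (\<exists>Q \<in> symmetric_mats n. det Q \<noteq> 0 \<and> X * Q \<in> symmetric_mats n)"

text \<open>Congruence carries the witness along: with \<open>Q' = V Q V^T\<close> one gets
  \<open>(V X W) Q' = V (X Q) V^T\<close>, because \<open>W V = 1\<close>.\<close>

lemma symmetrizable_similar:
  assumes X: "symmetrizable n X"
    and V: "V \<in> carrier_mat n n" and W: "W \<in> carrier_mat n n" and WV: "W * V = 1\<^sub>m n"
  shows "symmetrizable n (V * X * W)"
proof -
  obtain Q where Xc: "X \<in> carrier_mat n n" and Q: "Q \<in> symmetric_mats n" "det Q \<noteq> 0"
    and XQ: "X * Q \<in> symmetric_mats n"
    using X by (auto simp: symmetrizable_def)
  have Qc: "Q \<in> carrier_mat n n" using Q(1) by (rule symmetric_mats_carrier)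
  note [simp] = carrier_matD[OF Xc] carrier_matD[OF Qc] carrier_matD[OF V] carrier_matD[OF W]
  have dV: "det V \<noteq> 0"
    using inverse_det_nonzero[OF V W mat_mult_left_right_inverse[OF W V WV]] .
  let ?Q = "V * Q * transpose_mat V"
  have "V * X * W * ?Q = V * (X * Q) * transpose_mat V"
    by (simp add: mult_assoc_dim mult_cancel_inverse[OF WV])
  moreover have "det ?Q \<noteq> 0"
    using V Qc dV Q(2) by (simp add: det_mult[of _ n] det_transpose)
  ultimately show ?thesis
    unfolding symmetrizable_def
    using symmetric_mats_congruence[OF Q(1) V] symmetric_mats_congruence[OF XQ V] V W
    by (intro conjI bexI[of _ ?Q]) (simp_all add: carrier_matI)
qed

text \<open>Symmetry of \<open>X Q\<close> reads \<open>X Q = Q X^T\<close>. Multiplying by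
  \<open>R = Q^-1\<close> on both sides gives \<open>R X = X^T R\<close>, so \<open>R\<close> is a
  witness for \<open>X^T\<close>.\<close>

lemma symmetrizable_transpose:
  assumes X: "symmetrizable n X"
  shows "symmetrizable n (transpose_mat X)"
proof -
  obtain Q where Xc: "X \<in> carrier_mat n n" and Q: "Q \<in> symmetric_mats n" "det Q \<noteq> 0"
    and XQ: "X * Q \<in> symmetric_mats n"
    using X by (auto simp: symmetrizable_def)
  have Qc: "Q \<in> carrier_mat n n" using Q(1) by (rule symmetric_mats_carrier)
  obtain R where R: "R \<in> carrier_mat n n" and QR: "Q * R = 1\<^sub>m n" and RQ: "R * Q = 1\<^sub>m n"
    using det_nonzero_inverse[OF Qc Q(2)] .
  note [simp] = carrier_matD[OF Xc] carrier_matD[OF Qc] carrier_matD[OF R]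
  have Rs: "R \<in> symmetric_mats n" by (rule symmetric_mats_inverse[OF Q(1) R QR RQ])
  note tr = symmetric_mats_transpose[OF Rs] symmetric_mats_transpose[OF Q(1)]
  have "X * Q = Q * transpose_mat X"
    using symmetric_mats_transpose[OF XQ] tr by (simp add: transpose_mult_dim)
  then have "R * (X * Q) * R = R * (Q * transpose_mat X) * R" by simp
  then have "R * X = transpose_mat X * R"
    using QR Xc by (simp add: mult_assoc_dim mult_cancel_inverse[OF RQ])
  then have "transpose_mat X * R \<in> symmetric_mats n"
    using tr Xc R by (simp add: symmetric_mats_def transpose_mult_dim)
  then show ?thesis
    unfolding symmetrizable_def
    using Xc Rs inverse_det_nonzero[OF R Qc RQ] by auto
qed

section \<open>Block matrices and generic block triangular matrices\<close>

lemma four_block_mat_inject: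
  assumes "A \<in> carrier_mat n1 m1" "B \<in> carrier_mat n1 m2" "C \<in> carrier_mat n2 m1" "D \<in> carrier_mat n2 m2"
    and "A' \<in> carrier_mat n1 m1" "B' \<in> carrier_mat n1 m2" "C' \<in> carrier_mat n2 m1" "D' \<in> carrier_mat n2 m2"
  shows "four_block_mat A B C D = four_block_mat A' B' C' D' \<longleftrightarrow>
    A = A' \<and> B = B' \<and> C = C' \<and> D = D'" (is "?X = ?Y \<longleftrightarrow> _")
proof
  assume eq: "?X = ?Y"
  have *: "?X $$ (i, j) = ?Y $$ (i, j)" for i j using eq by simp
  show "A = A' \<and> B = B' \<and> C = C' \<and> D = D'"
  proof (intro conjI)
    show "A = A'"
    proof (rule eq_matI)
      fix i j assume "i < dim_row A'" "j < dim_col A'"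
      then show "A $$ (i, j) = A' $$ (i, j)" using *[of i j] assms by simp
    qed (use assms in auto)
    show "B = B'"
    proof (rule eq_matI)
      fix i j assume "i < dim_row B'" "j < dim_col B'"
      then show "B $$ (i, j) = B' $$ (i, j)" using *[of i "j + m1"] assms by simp
    qed (use assms in auto)
    show "C = C'"
    proof (rule eq_matI)
      fix i j assume "i < dim_row C'" "j < dim_col C'"
      then show "C $$ (i, j) = C' $$ (i, j)" using *[of "i + n1" j] assms by simp
    qed (use assms in auto)
    show "D = D'"
    proof (rule eq_matI)
      fix i j assume "i < dim_row D'" "j < dim_col D'"
      then show "D $$ (i, j) = D' $$ (i, j)" using *[of "i + n1" "j + m1"] assms by simp
    qed (use assms in auto)
  qed
qed auto

text \<open>As an introduction rule this leaves one goal per block, so that only the nontrivial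
  blocks need an argument of their own.\<close>

lemma mult_four_block_mat_eqI:
  assumes "A1 \<in> carrier_mat nr1 n1" "B1 \<in> carrier_mat nr1 n2"
    "C1 \<in> carrier_mat nr2 n1" "D1 \<in> carrier_mat nr2 n2"
    "A2 \<in> carrier_mat n1 nc1" "B2 \<in> carrier_mat n1 nc2"
    "C2 \<in> carrier_mat n2 nc1" "D2 \<in> carrier_mat n2 nc2"
    and "A1 * A2 + B1 * C2 = P" "A1 * B2 + B1 * D2 = Q"
    "C1 * A2 + D1 * C2 = R" "C1 * B2 + D1 * D2 = S"
  shows "four_block_mat A1 B1 C1 D1 * four_block_mat A2 B2 C2 D2 = four_block_mat P Q R S"
  using mult_four_block_mat[OF assms(1-8)] assms(9-12) by simp

lemma symmetric_mats_block_diag: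
  assumes "S \<in> symmetric_mats n" "T \<in> symmetric_mats m"
  shows "four_block_mat S (0\<^sub>m n m) (0\<^sub>m m n) T \<in> symmetric_mats (n + m)"
  using assms unfolding symmetric_mats_def
  by (auto simp: transpose_four_block_mat[of _ n n _ m _ m])

lemma symmetrizable_block_diag:
  assumes "symmetrizable n X" "symmetrizable m Y"
  shows "symmetrizable (n + m) (four_block_mat X (0\<^sub>m n m) (0\<^sub>m m n) Y)"
proof -
  obtain P Q where X: "X \<in> carrier_mat n n" and Y: "Y \<in> carrier_mat m m"
    and P: "P \<in> symmetric_mats n" "det P \<noteq> 0" "X * P \<in> symmetric_mats n"
    and Q: "Q \<in> symmetric_mats m" "det Q \<noteq> 0" "Y * Q \<in> symmetric_mats m"
    using assms by (auto simp: symmetrizable_def)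
  note c = symmetric_mats_carrier[OF P(1)] symmetric_mats_carrier[OF Q(1)]
  note [simp] = carrier_matD[OF c(1)] carrier_matD[OF c(2)] carrier_matD[OF X] carrier_matD[OF Y]
  let ?Q = "four_block_mat P (0\<^sub>m n m) (0\<^sub>m m n) Q"
  have "four_block_mat X (0\<^sub>m n m) (0\<^sub>m m n) Y * ?Q =
      four_block_mat (X * P) (0\<^sub>m n m) (0\<^sub>m m n) (Y * Q)"
    using X Y c by (subst mult_four_block_mat[of _ n n _ m _ m _ _ n _ m]) auto
  moreover have "det ?Q \<noteq> 0"
    using P Q c by (subst det_four_block_mat_upper_right_zero[of _ n _ m]) auto
  ultimately show ?thesis
    unfolding symmetrizable_def using X Y
    using symmetric_mats_block_diag[OF P(1) Q(1)] symmetric_mats_block_diag[OF P(3) Q(3)]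
    by (metis four_block_carrier_mat)
qed

lemma symmetrizable_one_dim:
  assumes "X \<in> carrier_mat 1 1"
  shows "symmetrizable 1 X"
proof -
  have "X \<in> symmetric_mats 1" "1\<^sub>m 1 \<in> symmetric_mats 1"
    using assms by (auto simp: symmetric_mats_def intro!: eq_matI)
  then show ?thesis using assms by (auto simp: symmetrizable_def intro!: bexI[of _ "1\<^sub>m 1"])
qed

lemma block_lower_unit_inverse:
  fixes z :: "'a :: comm_ring_1 mat"
  assumes z: "z \<in> carrier_mat m n"
  shows "four_block_mat (1\<^sub>m n) (0\<^sub>m n m) (- z) (1\<^sub>m m) *
         four_block_mat (1\<^sub>m n) (0\<^sub>m n m) z (1\<^sub>m m) = 1\<^sub>m (n + m)"
  using z
  by (subst mult_four_block_mat[of _ n n _ m _ m _ _ n _ m])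
     (auto simp: uminus_l_inv_mat)

text \<open>When \<open>g\<close> is not an eigenvalue of \<open>Y\<close>, the matrix is similar to \<open>diag(g, Y)\<close>.\<close>

lemma symmetrizable_block_lower:
  assumes Y: "symmetrizable m Y" and x: "x \<in> carrier_mat m 1"
    and g: "\<not> eigenvalue Y g"
  shows "symmetrizable (1 + m) (four_block_mat (g \<cdot>\<^sub>m 1\<^sub>m 1) (0\<^sub>m 1 m) x Y)"
proof -
  have Yc: "Y \<in> carrier_mat m m" using Y by (simp add: symmetrizable_def)
  define E where "E = char_matrix Y g"
  have E: "E \<in> carrier_mat m m" using Yc by (simp add: E_def)
  have "det E \<noteq> 0" using g eigenvalue_det[OF Yc] by (simp add: E_def)
  then obtain F where F: "F \<in> carrier_mat m m" and EF: "E * F = 1\<^sub>m m"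
    using det_nonzero_inverse[OF E] by metis
  \<comment> \<open>Conjugating \<open>diag(g, Y)\<close> by the unit lower triangular matrix with
    column \<open>z\<close> creates the lower left block \<open>g z - Y z\<close>. Solving
    \<open>(Y - g) z = - x\<close> turns it into \<open>x\<close>; the solution exists because
    \<open>E = Y - g\<close> is nonsingular.\<close>
  define z where "z = - (F * x)"
  have z: "z \<in> carrier_mat m 1" using F x by (simp add: z_def)
  note [simp] = carrier_matD[OF Yc] carrier_matD[OF E] carrier_matD[OF F] carrier_matD[OF x] carrier_matD[OF z]
  have "E * z = - x"
    using mult_cancel_inverse[OF EF, of x] by (simp add: z_def)
  moreover have "E * z = Y * z - g \<cdot>\<^sub>m z"
  proof -
    have "E = Y - g \<cdot>\<^sub>m 1\<^sub>m m"
      unfolding E_def char_matrix_def using Yc by (auto intro!: eq_matI)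
    moreover have "g \<cdot>\<^sub>m 1\<^sub>m m * z = g \<cdot>\<^sub>m z"
      using z mult_smult_assoc_mat[of "1\<^sub>m m" m m z 1 g] by simp
    ultimately show ?thesis by (simp add: minus_mult_dim)
  qed
  ultimately have Ez: "Y * z - g \<cdot>\<^sub>m z = - x" by simp
  have gzx: "g \<cdot>\<^sub>m z - Y * z = x"
  proof (rule eq_matI)
    fix i j assume ij: "i < dim_row x" "j < dim_col x"
    have "(Y * z - g \<cdot>\<^sub>m z) $$ (i, j) = (- x) $$ (i, j)" using Ez by simp
    then show "(g \<cdot>\<^sub>m z - Y * z) $$ (i, j) = x $$ (i, j)" using ij by simp
  qed auto
  let ?V = "four_block_mat (1\<^sub>m 1) (0\<^sub>m 1 m) z (1\<^sub>m m)"
  let ?W = "four_block_mat (1\<^sub>m 1) (0\<^sub>m 1 m) (- z) (1\<^sub>m m)"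
  let ?X = "four_block_mat (g \<cdot>\<^sub>m 1\<^sub>m 1) (0\<^sub>m 1 m) (0\<^sub>m m 1) Y"
  have X: "symmetrizable (1 + m) ?X"
    by (intro symmetrizable_block_diag symmetrizable_one_dim Y) auto
  have V: "?V \<in> carrier_mat (1 + m) (1 + m)" and W: "?W \<in> carrier_mat (1 + m) (1 + m)"
    by (rule four_block_carrier_mat; simp)+
  have "symmetrizable (1 + m) (?V * ?X * ?W)"
    by (rule symmetrizable_similar[OF X V W block_lower_unit_inverse[OF z]])
  also have "?V * ?X = four_block_mat (g \<cdot>\<^sub>m 1\<^sub>m 1) (0\<^sub>m 1 m) (g \<cdot>\<^sub>m z) Y"
  proof (rule mult_four_block_mat_eqI[of _ 1 1 _ m _ m _ _ 1 _ m])
    show "z * (g \<cdot>\<^sub>m 1\<^sub>m 1) + 1\<^sub>m m * 0\<^sub>m m 1 = g \<cdot>\<^sub>m z"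
      using z mult_smult_distrib[of z m 1 "1\<^sub>m 1" 1 g] by simp
  qed (use z Yc in auto)
  also have "\<dots> * ?W = four_block_mat (g \<cdot>\<^sub>m 1\<^sub>m 1) (0\<^sub>m 1 m) (g \<cdot>\<^sub>m z - Y * z) Y"
  proof (rule mult_four_block_mat_eqI[of _ 1 1 _ m _ m _ _ 1 _ m])
    show "g \<cdot>\<^sub>m z * 1\<^sub>m 1 + Y * - z = g \<cdot>\<^sub>m z - Y * z"
      by (rule eq_matI) (use z in auto)
  qed (use z Yc in \<open>auto intro!: eq_matI\<close>)
  finally show ?thesis by (simp add: gzx)
qed

text \<open>This is the transpose of the lower triangular case. The condition on \<open>g\<close>
  survives since \<open>Y - g\<close> and its transpose have the same determinant.\<close>

lemma symmetrizable_block_upper: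
  assumes Y: "symmetrizable m Y" and y: "y \<in> carrier_mat 1 m"
    and g: "\<not> eigenvalue Y g"
  shows "symmetrizable (1 + m) (four_block_mat (g \<cdot>\<^sub>m 1\<^sub>m 1) y (0\<^sub>m m 1) Y)"
proof -
  have Yc: "Y \<in> carrier_mat m m" using Y by (simp add: symmetrizable_def)
  have ev: "\<not> eigenvalue (transpose_mat Y) g"
  proof -
    have "char_matrix (transpose_mat Y) g = transpose_mat (char_matrix Y g)"
      using Yc by (auto simp: char_matrix_def intro!: eq_matI)
    moreover have "char_matrix Y g \<in> carrier_mat m m" using Yc by simp
    ultimately show ?thesis
      using g Yc by (simp add: eigenvalue_det[of _ m] det_transpose[of _ m])
  qed
  have "symmetrizable (1 + m) (transpose_mat
      (four_block_mat (g \<cdot>\<^sub>m 1\<^sub>m 1) (0\<^sub>m 1 m) (transpose_mat y) (transpose_mat Y)))"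
    by (intro symmetrizable_transpose symmetrizable_block_lower ev Y) (use y in auto)
  moreover have "transpose_mat (g \<cdot>\<^sub>m 1\<^sub>m 1) = (g \<cdot>\<^sub>m 1\<^sub>m 1 :: real mat)"
    by (auto intro!: eq_matI)
  ultimately show ?thesis
    using y Yc by (simp add: transpose_four_block_mat[of _ 1 1 _ m _ m])
qed

text \<open>Eigenvalues are roots of the monic characteristic polynomial. Over the reals this leaves
  infinitely many admissible diagonal entries \<open>g\<close>.\<close>

lemma finite_eigenvalues:
  fixes A :: "'a :: field mat"
  assumes A: "A \<in> carrier_mat n n"
  shows "finite {g. eigenvalue A g}"
proof -
  have "char_poly A \<noteq> 0" using degree_monic_char_poly[OF A] by auto
  then show ?thesis using poly_roots_finite eigenvalue_root_char_poly[OF A] by auto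
qed

section \<open>Quotients of symmetrizable matrices by Gaussian elimination\<close>

lemma symmetrizable_one: "symmetrizable n (1\<^sub>m n)"
proof -
  have "1\<^sub>m n \<in> symmetric_mats n" by (simp add: symmetric_mats_def)
  then show ?thesis by (auto simp: symmetrizable_def intro!: bexI[of _ "1\<^sub>m n"])
qed

lemma mat_1_1_eq_smult_one:
  fixes a :: "'a :: semiring_1 mat"
  assumes "a \<in> carrier_mat 1 1"
  shows "a = a $$ (0, 0) \<cdot>\<^sub>m 1\<^sub>m 1"
  using assms by (auto intro!: eq_matI)

text \<open>The name refers to \<open>A = G^-1 (G A)\<close>. The matrix \<open>G\<close> is what
  two extra triangular factors will multiply onto the upper left block.\<close>

definition symmetrizable_quotient :: "nat \<Rightarrow> real mat \<Rightarrow> bool" where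
  "symmetrizable_quotient n A \<longleftrightarrow>
     (\<exists>G. symmetrizable n G \<and> det G \<noteq> 0 \<and> symmetrizable n (G * A))"

text \<open>A multiplier \<open>G\<close> for \<open>V A W\<close> pulls back to
  \<open>W G V\<close>, since \<open>(W G V) A = W (G (V A W)) V\<close>: both matrices to be
  symmetrized are conjugates of the given ones.\<close>

lemma symmetrizable_quotient_similar:
  assumes q: "symmetrizable_quotient n (V * A * W)"
    and A: "A \<in> carrier_mat n n"
    and V: "V \<in> carrier_mat n n" and W: "W \<in> carrier_mat n n" and WV: "W * V = 1\<^sub>m n"
  shows "symmetrizable_quotient n A"
proof -
  obtain G where G: "symmetrizable n G" "det G \<noteq> 0" and GA: "symmetrizable n (G * (V * A * W))"
    using q by (auto simp: symmetrizable_quotient_def)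
  have Gc: "G \<in> carrier_mat n n" using G by (simp add: symmetrizable_def)
  have VW: "V * W = 1\<^sub>m n" by (rule mat_mult_left_right_inverse[OF W V WV])
  note [simp] = carrier_matD[OF Gc] carrier_matD[OF A] carrier_matD[OF V] carrier_matD[OF W]
  have "det V \<noteq> 0" "det W \<noteq> 0"
    using inverse_det_nonzero[OF V W VW] inverse_det_nonzero[OF W V WV] by auto
  then have "det (W * G * V) \<noteq> 0"
    using Gc V W G(2) by (simp add: det_mult[of _ n])
  moreover have "W * G * V * A = W * (G * (V * A * W)) * V"
    using A by (simp add: mult_assoc_dim WV)
  ultimately show ?thesis
    unfolding symmetrizable_quotient_def
    using symmetrizable_similar[OF G(1) W V VW] symmetrizable_similar[OF GA W V VW]
    by (intro exI[of _ "W * G * V"]) simp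
qed

text \<open>If \<open>G\<close> works for the Schur complement, then \<open>[[g, 0], [-G x / a, G]]\<close> works for the
  whole matrix: it clears the first column. Only finitely many \<open>g\<close> are excluded by the
  eigenvalue conditions on the two block triangular matrices.\<close>

lemma symmetrizable_quotient_pivot:
  fixes a :: real
  assumes y: "y \<in> carrier_mat 1 m" and x: "x \<in> carrier_mat m 1" and R: "R \<in> carrier_mat m m"
    and a: "a \<noteq> 0"
    and q: "symmetrizable_quotient m (R - (1 / a) \<cdot>\<^sub>m (x * y))"
  shows "symmetrizable_quotient (1 + m) (four_block_mat (a \<cdot>\<^sub>m 1\<^sub>m 1) y x R)"
proof -
  let ?S = "R - (1 / a) \<cdot>\<^sub>m (x * y)"
  have S: "?S \<in> carrier_mat m m" using R x y by (intro carrier_matI) auto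
  obtain G where G: "symmetrizable m G" "det G \<noteq> 0" and GS: "symmetrizable m (G * ?S)"
    using q by (auto simp: symmetrizable_quotient_def)
  have Gc: "G \<in> carrier_mat m m" using G by (simp add: symmetrizable_def)
  have Nc: "G * ?S \<in> carrier_mat m m" using Gc S by (rule mult_carrier_mat)
  note [simp] = carrier_matD[OF Gc] carrier_matD[OF x] carrier_matD[OF y] carrier_matD[OF R]
  \<comment> \<open>The three excluded sets keep \<open>?G\<close> nonsingular, \<open>?G\<close>
    symmetrizable and the product symmetrizable. The corner of the product is \<open>g * a\<close>,
    hence the division by \<open>a\<close> in the third set.\<close>
  have "finite ({0} \<union> {g. eigenvalue G g} \<union> (\<lambda>g. g / a) ` {g. eigenvalue (G * ?S) g})"
    using finite_eigenvalues[OF Gc] finite_eigenvalues[OF Nc] by auto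
  then obtain g where "g \<notin> {0} \<union> {g. eigenvalue G g} \<union> (\<lambda>g. g / a) ` {g. eigenvalue (G * ?S) g}"
    using ex_new_if_finite[OF infinite_UNIV_char_0] by metis
  then have g: "g \<noteq> 0" "\<not> eigenvalue G g" and "\<not> eigenvalue (G * ?S) (g * a)"
    using a by (auto simp: image_iff)
  define z where "z = - ((1 / a) \<cdot>\<^sub>m (G * x))"
  have z: "z \<in> carrier_mat m 1" by (intro carrier_matI) (auto simp: z_def)
  note [simp] = carrier_matD[OF z]
  let ?G = "four_block_mat (g \<cdot>\<^sub>m 1\<^sub>m 1) (0\<^sub>m 1 m) z G"
  have "symmetrizable (1 + m) ?G"
    by (rule symmetrizable_block_lower[OF G(1) z g(2)])
  moreover have "det ?G \<noteq> 0"
    using Gc z G(2) g(1)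
    by (subst det_four_block_mat_upper_right_zero[of _ 1 _ m]) auto
  moreover have "?G * four_block_mat (a \<cdot>\<^sub>m 1\<^sub>m 1) y x R =
      four_block_mat ((g * a) \<cdot>\<^sub>m 1\<^sub>m 1) (g \<cdot>\<^sub>m y) (0\<^sub>m m 1) (G * ?S)"
  proof -
    have "a \<cdot>\<^sub>m z + G * x = 0\<^sub>m m 1"
      using a by (intro eq_matI) (auto simp: z_def)
    moreover have "z * y + G * R = G * ?S"
    proof -
      have "z * y = - ((1 / a) \<cdot>\<^sub>m (G * (x * y)))"
      proof -
        have "(1 / a) \<cdot>\<^sub>m (G * x) * y = (1 / a) \<cdot>\<^sub>m (G * x * y)"
          by (rule mult_smult_assoc_mat[of _ m 1 _ m]) (auto intro: carrier_matI)
        then show ?thesis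
          unfolding z_def by (simp add: mult_assoc_dim)
      qed
      moreover have "G * ?S = G * R - (1 / a) \<cdot>\<^sub>m (G * (x * y))"
        by (simp add: mult_minus_dim mult_smult_distrib[of _ m m _ m] carrier_matI)
      ultimately show ?thesis
        by (intro eq_matI) auto
    qed
    moreover have "g \<cdot>\<^sub>m 1\<^sub>m 1 * (a \<cdot>\<^sub>m 1\<^sub>m 1) = (g * a) \<cdot>\<^sub>m (1\<^sub>m 1 :: real mat)"
      by (auto intro!: eq_matI simp: scalar_prod_def)
    moreover have "g \<cdot>\<^sub>m 1\<^sub>m 1 * y = g \<cdot>\<^sub>m y"
      using y mult_smult_assoc_mat[of "1\<^sub>m 1" 1 1 y m g] by simp
    moreover have "z * (a \<cdot>\<^sub>m 1\<^sub>m 1) = a \<cdot>\<^sub>m z"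
      using z mult_smult_distrib[of z m 1 "1\<^sub>m 1" 1 a] by simp
    ultimately show ?thesis
      using x y R Gc z by (intro mult_four_block_mat_eqI[of _ 1 1 _ m _ m _ _ 1 _ m]) simp_all
  qed
  moreover have "symmetrizable (1 + m)
      (four_block_mat ((g * a) \<cdot>\<^sub>m 1\<^sub>m 1) (g \<cdot>\<^sub>m y) (0\<^sub>m m 1) (G * ?S))"
    by (rule symmetrizable_block_upper[OF GS]) (use y \<open>\<not> eigenvalue _ (g * a)\<close> in auto)
  ultimately show ?thesis
    unfolding symmetrizable_quotient_def by (intro exI[of _ ?G]) simp
qed

text \<open>Block LU factorization: \<open>?L\<close> has determinant 1 and \<open>?U\<close> has
  the diagonal blocks \<open>a\<close> and \<open>?S\<close>. It passes nonsingularity on to the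
  Schur complement.\<close>

lemma schur_complement_det:
  fixes a :: "'a :: field"
  assumes y: "y \<in> carrier_mat 1 m" and x: "x \<in> carrier_mat m 1" and R: "R \<in> carrier_mat m m"
    and a: "a \<noteq> 0"
  shows "det (four_block_mat (a \<cdot>\<^sub>m 1\<^sub>m 1) y x R) = a * det (R - (1 / a) \<cdot>\<^sub>m (x * y))"
proof -
  note [simp] = carrier_matD[OF x] carrier_matD[OF y] carrier_matD[OF R]
  let ?S = "R - (1 / a) \<cdot>\<^sub>m (x * y)"
  let ?L = "four_block_mat (1\<^sub>m 1) (0\<^sub>m 1 m) ((1 / a) \<cdot>\<^sub>m x) (1\<^sub>m m)"
  let ?U = "four_block_mat (a \<cdot>\<^sub>m 1\<^sub>m 1) y (0\<^sub>m m 1) ?S"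
  have S: "?S \<in> carrier_mat m m" by (intro carrier_matI) auto
  have 1: "(1 / a) \<cdot>\<^sub>m x * (a \<cdot>\<^sub>m 1\<^sub>m 1) = x"
    using a x by (auto intro!: eq_matI simp: scalar_prod_def)
  have 2: "(1 / a) \<cdot>\<^sub>m x * y = (1 / a) \<cdot>\<^sub>m (x * y)"
    by (rule mult_smult_assoc_mat[OF x y])
  have "?L * ?U = four_block_mat (a \<cdot>\<^sub>m 1\<^sub>m 1) y x R"
  proof (rule mult_four_block_mat_eqI[of _ 1 1 _ m _ m _ _ 1 _ m])
    show "(1 / a) \<cdot>\<^sub>m x * y + 1\<^sub>m m * ?S = R"
      unfolding 2 left_mult_one_mat[OF S] by (rule eq_matI) auto
    show "(1 / a) \<cdot>\<^sub>m x * (a \<cdot>\<^sub>m 1\<^sub>m 1) + 1\<^sub>m m * 0\<^sub>m m 1 = x"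
      unfolding 1 using x by simp
  qed (use x y R S in auto)
  moreover have "det (?L * ?U) = det ?L * det ?U"
    by (rule det_mult[of _ "1 + m"]; rule four_block_carrier_mat; use S in simp)
  moreover have "det ?L = 1"
    using x by (subst det_four_block_mat_upper_right_zero[of _ 1 _ m]) auto
  moreover have "det ?U = a * det ?S"
    using y S by (subst det_four_block_mat_lower_left_zero[of _ 1 _ m]) auto
  ultimately show ?thesis by simp
qed

text \<open>If the pivot vanishes, conjugating by the unit lower triangular matrix with column
  \<open>y\<^sup>T\<close> replaces it by \<open>y y\<^sup>T\<close>, which is nonzero as \<open>y\<close> is.\<close>

lemma similar_nonzero_pivot:
  fixes A :: "real mat"
  assumes A: "A \<in> carrier_mat (1 + m) (1 + m)" and dA: "det A \<noteq> 0"
  obtains V W a y x R where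
    "V \<in> carrier_mat (1 + m) (1 + m)" "W \<in> carrier_mat (1 + m) (1 + m)" "W * V = 1\<^sub>m (1 + m)"
    "a \<noteq> 0" "y \<in> carrier_mat 1 m" "x \<in> carrier_mat m 1" "R \<in> carrier_mat m m"
    "V * A * W = four_block_mat (a \<cdot>\<^sub>m 1\<^sub>m 1) y x R"
proof -
  obtain a y x R where "split_block A 1 1 = (a, y, x, R)" by (metis prod_cases4)
  from split_block[OF this, of m m] A
  have a: "a \<in> carrier_mat 1 1" and y: "y \<in> carrier_mat 1 m" and x: "x \<in> carrier_mat m 1"
    and R: "R \<in> carrier_mat m m" and A_eq: "A = four_block_mat a y x R" by auto
  note [simp] = carrier_matD[OF a] carrier_matD[OF x] carrier_matD[OF y] carrier_matD[OF R]
  \<comment> \<open>The entry \<open>a + y z\<close> will be the corner after conjugation by the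
    matrix with column \<open>z\<close>. A nonzero \<open>a\<close> allows
    \<open>z = 0\<close>.\<close>
  have "\<exists>z \<in> carrier_mat m 1. (a + y * z) $$ (0, 0) \<noteq> 0"
  proof (cases "a $$ (0, 0) = 0")
    case False
    then show ?thesis using y by (intro bexI[of _ "0\<^sub>m m 1"]) auto
  next
    case True
    \<comment> \<open>Otherwise the first row of \<open>A\<close> would vanish, against
      \<open>det A \<noteq> 0\<close>.\<close>
    have "row y 0 \<noteq> 0\<^sub>v m"
    proof
      assume y0: "row y 0 = 0\<^sub>v m"
      have "y = 0\<^sub>m 1 m"
      proof (rule eq_matI)
        fix i j assume "i < dim_row (0\<^sub>m 1 m)" "j < dim_col (0\<^sub>m 1 m)"
        then show "y $$ (i, j) = 0\<^sub>m 1 m $$ (i, j)"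
          using arg_cong[OF y0, of "\<lambda>v. v $ j"] by simp
      qed auto
      moreover have "det a = 0"
        using True a by (simp add: det_single)
      ultimately show False
        using dA a x R by (simp add: A_eq det_four_block_mat_upper_right_zero[of _ 1 _ m])
    qed
    then obtain j where j: "j < m" "y $$ (0, j) \<noteq> 0"
      by (auto simp: vec_eq_iff)
    have "row y 0 \<bullet> row y 0 = (\<Sum>i<m. (y $$ (0, i))\<^sup>2)"
      by (simp add: scalar_prod_def power2_eq_square atLeast0LessThan)
    also have "\<dots> > 0"
      using j by (intro sum_pos2[of _ j]) auto
    finally have "row y 0 \<bullet> row y 0 \<noteq> 0" by simp
    then show ?thesis
      using True y by (intro bexI[of _ "transpose_mat y"]) auto
  qed
  then obtain z where z: "z \<in> carrier_mat m 1" and az: "(a + y * z) $$ (0, 0) \<noteq> 0" by auto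
  note [simp] = carrier_matD[OF z]
  let ?V = "four_block_mat (1\<^sub>m 1) (0\<^sub>m 1 m) (- z) (1\<^sub>m m)"
  let ?W = "four_block_mat (1\<^sub>m 1) (0\<^sub>m 1 m) z (1\<^sub>m m)"
  have V: "?V \<in> carrier_mat (1 + m) (1 + m)" and W: "?W \<in> carrier_mat (1 + m) (1 + m)"
    by (rule four_block_carrier_mat; simp)+
  have VW: "?V * ?W = 1\<^sub>m (1 + m)" by (rule block_lower_unit_inverse[OF z])
  have c: "- z * a + x \<in> carrier_mat m 1" "- z * y + R \<in> carrier_mat m m" "a + y * z \<in> carrier_mat 1 1"
    by (auto intro!: carrier_matI)
  have "?V * A = four_block_mat a y (- z * a + x) (- z * y + R)"
    unfolding A_eq by (rule mult_four_block_mat_eqI[of _ 1 1 _ m _ m _ _ 1 _ m]) (use a x y R z in auto)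
  also have "\<dots> * ?W = four_block_mat (a + y * z) y (- z * a + x + (- z * y + R) * z) (- z * y + R)"
    by (rule mult_four_block_mat_eqI[of _ 1 1 _ m _ m _ _ 1 _ m]) (use a y z c in auto)
  also have "a + y * z = (a + y * z) $$ (0, 0) \<cdot>\<^sub>m 1\<^sub>m 1"
    by (rule mat_1_1_eq_smult_one[OF c(3)])
  finally show ?thesis
    using V W mat_mult_left_right_inverse[OF V W VW] az y c
    by (intro that[of ?V ?W "(a + y * z) $$ (0, 0)" y "- z * a + x + (- z * y + R) * z" "- z * y + R"])
       (auto intro!: carrier_matI)
qed

text \<open>Induction on the size: conjugate to a nonzero pivot, apply the hypothesis to the Schur
  complement, which is again nonsingular, then undo both reductions.\<close>

lemma nonsingular_symmetrizable_quotient: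
  assumes "A \<in> carrier_mat n n" and "det A \<noteq> 0"
  shows "symmetrizable_quotient n A"
  using assms
proof (induction n arbitrary: A)
  case 0
  then have "A = 1\<^sub>m 0" by (auto intro!: eq_matI)
  then show ?case
    using symmetrizable_one[of 0] unfolding symmetrizable_quotient_def
    by (intro exI[of _ "1\<^sub>m 0"]) auto
next
  case (Suc m)
  have Ac: "A \<in> carrier_mat (1 + m) (1 + m)" using Suc.prems by simp
  obtain V W a y x R where V: "V \<in> carrier_mat (1 + m) (1 + m)"
    and W: "W \<in> carrier_mat (1 + m) (1 + m)" and WV: "W * V = 1\<^sub>m (1 + m)"
    and a: "a \<noteq> 0" and y: "y \<in> carrier_mat 1 m" and x: "x \<in> carrier_mat m 1"
    and R: "R \<in> carrier_mat m m"
    and eq: "V * A * W = four_block_mat (a \<cdot>\<^sub>m 1\<^sub>m 1) y x R"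
    using similar_nonzero_pivot[OF Ac Suc.prems(2)] .
  have "det (V * A * W) = det V * det A * det W"
    using V W Ac by (simp add: det_mult[of _ "Suc m"])
  moreover have "det W * det V = 1"
    using det_mult[OF W V] WV by simp
  ultimately have "det (V * A * W) \<noteq> 0"
    using Suc.prems(2) by (metis mult_eq_0_iff zero_neq_one)
  then have "det (R - (1 / a) \<cdot>\<^sub>m (x * y)) \<noteq> 0"
    using schur_complement_det[OF y x R a] by (simp add: eq)
  moreover have "R - (1 / a) \<cdot>\<^sub>m (x * y) \<in> carrier_mat m m"
    using x y R by (intro carrier_matI) auto
  ultimately have "symmetrizable_quotient m (R - (1 / a) \<cdot>\<^sub>m (x * y))"
    using Suc.IH by blast
  then have "symmetrizable_quotient (1 + m) (V * A * W)"
    unfolding eq by (rule symmetrizable_quotient_pivot[OF y x R a])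
  then show ?case
    using symmetrizable_quotient_similar[OF _ Ac V W WV] by simp
qed

section \<open>Unit triangular and symplectic matrices in block form\<close>

lemma upper_unit_carrier: "upper_unit d S \<in> carrier_mat (2 * d) (2 * d)"
  using four_block_carrier_mat[of "1\<^sub>m d" d d "1\<^sub>m d" d d] by (simp add: upper_unit_def mult_2)

lemma lower_unit_carrier: "lower_unit d S \<in> carrier_mat (2 * d) (2 * d)"
  using four_block_carrier_mat[of "1\<^sub>m d" d d "1\<^sub>m d" d d] by (simp add: lower_unit_def mult_2)

lemma upper_unit_mult:
  assumes "S \<in> carrier_mat d d" "A \<in> carrier_mat d d" "B \<in> carrier_mat d d"
    "C \<in> carrier_mat d d" "D \<in> carrier_mat d d"
  shows "upper_unit d S * four_block_mat A B C D = four_block_mat (A + S * C) (B + S * D) C D"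
  unfolding upper_unit_def
  by (rule mult_four_block_mat_eqI[of _ d d _ d _ d _ _ d _ d]) (use assms in simp_all)

lemma lower_unit_mult:
  assumes "S \<in> carrier_mat d d" "A \<in> carrier_mat d d" "B \<in> carrier_mat d d"
    "C \<in> carrier_mat d d" "D \<in> carrier_mat d d"
  shows "lower_unit d S * four_block_mat A B C D = four_block_mat A B (S * A + C) (S * B + D)"
  unfolding lower_unit_def
  by (rule mult_four_block_mat_eqI[of _ d d _ d _ d _ _ d _ d]) (use assms in simp_all)

lemma upper_unit_cancel:
  assumes S: "S \<in> carrier_mat d d" and X: "X \<in> carrier_mat (2 * d) (2 * d)"
  shows "upper_unit d (- S) * (upper_unit d S * X) = X"
proof (rule mult_cancel_inverse)
  have "upper_unit d (- S) * upper_unit d S = four_block_mat (1\<^sub>m d) (S + - S) (0\<^sub>m d d) (1\<^sub>m d)"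
    using S by (subst (2) upper_unit_def) (simp add: upper_unit_mult)
  also have "S + - S = 0\<^sub>m d d" using S by (intro eq_matI) auto
  finally show "upper_unit d (- S) * upper_unit d S = 1\<^sub>m (2 * d)"
    by (simp add: mult_2)
qed (use X carrier_matD[OF upper_unit_carrier] in auto)

lemma lower_unit_cancel:
  assumes S: "S \<in> carrier_mat d d" and X: "X \<in> carrier_mat (2 * d) (2 * d)"
  shows "lower_unit d (- S) * (lower_unit d S * X) = X"
proof (rule mult_cancel_inverse)
  have "lower_unit d (- S) * lower_unit d S = four_block_mat (1\<^sub>m d) (0\<^sub>m d d) (- S + S) (1\<^sub>m d)"
    using S by (subst (2) lower_unit_def) (simp add: lower_unit_mult)
  also have "- S + S = 0\<^sub>m d d" using S by (simp add: uminus_l_inv_mat)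
  finally show "lower_unit d (- S) * lower_unit d S = 1\<^sub>m (2 * d)"
    by (simp add: mult_2)
qed (use X carrier_matD[OF lower_unit_carrier] in auto)

lemma symplectic_form_carrier: "symplectic_form d \<in> carrier_mat (2 * d) (2 * d)"
  using four_block_carrier_mat[of "0\<^sub>m d d" d d "0\<^sub>m d d" d d]
  by (simp add: symplectic_form_def mult_2)

lemma symplectic_mult:
  assumes X: "symplectic d X" and Y: "symplectic d Y"
  shows "symplectic d (X * Y)"
proof -
  have c: "X \<in> carrier_mat (2 * d) (2 * d)" "Y \<in> carrier_mat (2 * d) (2 * d)"
    and X': "transpose_mat X * symplectic_form d * X = symplectic_form d"
    and Y': "transpose_mat Y * symplectic_form d * Y = symplectic_form d"
    using X Y by (auto simp: symplectic_def)
  note [simp] = carrier_matD[OF c(1)] carrier_matD[OF c(2)] carrier_matD[OF symplectic_form_carrier]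
  have "transpose_mat (X * Y) * symplectic_form d * (X * Y) =
      transpose_mat Y * (transpose_mat X * symplectic_form d * X) * Y"
    by (simp add: transpose_mult_dim mult_assoc_dim)
  then show ?thesis using c X' Y' by (simp add: symplectic_def)
qed

lemma symplectic_four_block_iff:
  assumes A: "A \<in> carrier_mat d d" and B: "B \<in> carrier_mat d d"
    and C: "C \<in> carrier_mat d d" and D: "D \<in> carrier_mat d d"
  shows "symplectic d (four_block_mat A B C D) \<longleftrightarrow>
    transpose_mat A * C - transpose_mat C * A = 0\<^sub>m d d \<and>
    transpose_mat A * D - transpose_mat C * B = 1\<^sub>m d \<and>
    transpose_mat B * C - transpose_mat D * A = - 1\<^sub>m d \<and>
    transpose_mat B * D - transpose_mat D * B = 0\<^sub>m d d"
proof -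
  note [simp] = carrier_matD[OF A] carrier_matD[OF B] carrier_matD[OF C] carrier_matD[OF D]
  have c: "four_block_mat A B C D \<in> carrier_mat (2 * d) (2 * d)"
    using four_block_carrier_mat[OF A D] by (simp add: mult_2)
  have "transpose_mat (four_block_mat A B C D) * symplectic_form d =
    four_block_mat (- transpose_mat C) (transpose_mat A) (- transpose_mat D) (transpose_mat B)"
    unfolding transpose_four_block_mat[OF A B C D] symplectic_form_def
    by (rule mult_four_block_mat_eqI[of _ d d _ d _ d _ _ d _ d]) (use A B C D in simp_all)
  also have "\<dots> * four_block_mat A B C D = four_block_mat
      (transpose_mat A * C - transpose_mat C * A) (transpose_mat A * D - transpose_mat C * B)
      (transpose_mat B * C - transpose_mat D * A) (transpose_mat B * D - transpose_mat D * B)"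
    by (rule mult_four_block_mat_eqI[of _ d d _ d _ d _ _ d _ d];
        (rule eq_matI)?) (use A B C D in simp_all)
  finally have eq: "transpose_mat (four_block_mat A B C D) * symplectic_form d * four_block_mat A B C D = \<dots>" .
  show ?thesis
    unfolding symplectic_def eq unfolding symplectic_form_def
    using c by (subst four_block_mat_inject[of _ d d _ d _ d])
      (auto intro!: carrier_matI)
qed

lemma minus_eq_zero_mat:
  fixes X :: "'a :: group_add mat"
  assumes "X - Y = 0\<^sub>m n m" "X \<in> carrier_mat n m" "Y \<in> carrier_mat n m"
  shows "X = Y"
proof (rule eq_matI)
  fix i j assume "i < dim_row Y" "j < dim_col Y"
  then show "X $$ (i, j) = Y $$ (i, j)"
    using arg_cong[OF assms(1), of "\<lambda>Z. Z $$ (i, j)"] assms(2,3) by simp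
qed (use assms in auto)

lemma symplectic_four_blockD:
  assumes A: "A \<in> carrier_mat d d" and B: "B \<in> carrier_mat d d"
    and C: "C \<in> carrier_mat d d" and D: "D \<in> carrier_mat d d"
    and sp: "symplectic d (four_block_mat A B C D)"
  shows "transpose_mat A * C = transpose_mat C * A"
    "transpose_mat A * D - transpose_mat C * B = 1\<^sub>m d"
    "transpose_mat B * D = transpose_mat D * B"
proof -
  note * = sp[unfolded symplectic_four_block_iff[OF A B C D]]
  show "transpose_mat A * C = transpose_mat C * A"
    by (rule minus_eq_zero_mat[OF conjunct1[OF *]]; rule mult_carrier_mat[of _ d d]) (use A C in simp_all)
  show "transpose_mat A * D - transpose_mat C * B = 1\<^sub>m d"
    using * by (elim conjE)
  have BD: "transpose_mat B * D - transpose_mat D * B = 0\<^sub>m d d"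
    using * by (elim conjE)
  show "transpose_mat B * D = transpose_mat D * B"
    by (rule minus_eq_zero_mat[OF BD]; rule mult_carrier_mat[of _ d d]) (use B D in simp_all)
qed

lemma symplectic_upper_unit:
  assumes "S \<in> symmetric_mats d"
  shows "symplectic d (upper_unit d S)"
  using assms unfolding upper_unit_def symmetric_mats_def
  by (subst symplectic_four_block_iff) (auto intro!: eq_matI)

lemma symplectic_lower_unit:
  assumes "S \<in> symmetric_mats d"
  shows "symplectic d (lower_unit d S)"
  using assms unfolding lower_unit_def symmetric_mats_def
  by (subst symplectic_four_block_iff) (auto intro!: eq_matI)

text \<open>With \<open>R = A^-1\<close>, \<open>C R = R^T (A^T C) R\<close>, and exchanging
  \<open>A^T C\<close> for \<open>C^T A\<close> turns this into \<open>R^T C^T\<close>.\<close>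

lemma symmetric_left_quotient:
  assumes A: "A \<in> carrier_mat d d" and C: "C \<in> carrier_mat d d" and R: "R \<in> carrier_mat d d"
    and AR: "A * R = 1\<^sub>m d" and AC: "transpose_mat A * C = transpose_mat C * A"
  shows "C * R \<in> symmetric_mats d"
proof -
  note [simp] = carrier_matD[OF A] carrier_matD[OF C] carrier_matD[OF R]
  have RA: "transpose_mat R * transpose_mat A = 1\<^sub>m d"
    using arg_cong[OF AR, of transpose_mat] by (simp add: transpose_mult_dim)
  have "C * R = transpose_mat R * (transpose_mat A * C) * R"
    by (simp add: mult_assoc_dim mult_cancel_inverse[OF RA])
  also have "\<dots> = transpose_mat R * transpose_mat C * (A * R)"
    unfolding AC by (simp add: mult_assoc_dim)
  also have "\<dots> = transpose_mat (C * R)"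
    using C R by (simp add: AR transpose_mult_dim)
  finally show ?thesis using C R by (simp add: symmetric_mats_def)
qed

section \<open>Six factors for a symmetrizable upper left block\<close>

text \<open>With \<open>A = P Q\<^sup>-\<^sup>1\<close>, where \<open>P = A Q\<close>, the block diagonal part
  \<open>diag(A, A\<^sup>-\<^sup>T)\<close> is the product of the antidiagonal matrices
  \<open>[[0, P], [-P\<^sup>-\<^sup>1, 0]]\<close> and \<open>[[0, -Q], [Q\<^sup>-\<^sup>1, 0]]\<close>; each of these is a product
  upper-lower-upper, and the two adjacent upper factors merge.\<close>

lemma symplectic_six_factors:
  assumes A: "A \<in> carrier_mat d d" and B: "B \<in> carrier_mat d d"
    and C: "C \<in> carrier_mat d d" and D: "D \<in> carrier_mat d d"
    and sp: "symplectic d (four_block_mat A B C D)"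
    and sA: "symmetrizable d A" and dA: "det A \<noteq> 0"
  obtains S1 S2 S3 S4 S5 S6 where "{S1, S2, S3, S4, S5, S6} \<subseteq> symmetric_mats d"
    "four_block_mat A B C D = lower_unit d S6 * (upper_unit d S5 * (lower_unit d S4 *
       (upper_unit d S3 * (lower_unit d S2 * upper_unit d S1))))"
proof -
  obtain Q where Q: "Q \<in> symmetric_mats d" and dQ: "det Q \<noteq> 0" and P: "A * Q \<in> symmetric_mats d"
    using sA by (auto simp: symmetrizable_def)
  define P where "P = A * Q"
  have P: "P \<in> symmetric_mats d" using P by (simp add: P_def)
  have Qc: "Q \<in> carrier_mat d d" and Pc: "P \<in> carrier_mat d d"
    using Q P by (auto intro: symmetric_mats_carrier)
  have dP: "det P \<noteq> 0" using dA dQ by (simp add: P_def det_mult[OF A Qc])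
  obtain Pi where Pi: "Pi \<in> carrier_mat d d" and PPi: "P * Pi = 1\<^sub>m d" and PiP: "Pi * P = 1\<^sub>m d"
    using det_nonzero_inverse[OF Pc dP] .
  obtain Qi where Qi: "Qi \<in> carrier_mat d d" and QQi: "Q * Qi = 1\<^sub>m d" and QiQ: "Qi * Q = 1\<^sub>m d"
    using det_nonzero_inverse[OF Qc dQ] .
  note [simp] = carrier_matD[OF A] carrier_matD[OF B] carrier_matD[OF C] carrier_matD[OF D]
    carrier_matD[OF Pc] carrier_matD[OF Qc] carrier_matD[OF Pi] carrier_matD[OF Qi]
  have Pis: "Pi \<in> symmetric_mats d" by (rule symmetric_mats_inverse[OF P Pi PPi PiP])
  have Qis: "Qi \<in> symmetric_mats d" by (rule symmetric_mats_inverse[OF Q Qi QQi QiQ])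
  note tr = symmetric_mats_transpose[OF P] symmetric_mats_transpose[OF Q]
    symmetric_mats_transpose[OF Pis] symmetric_mats_transpose[OF Qis]
  note cancel = mult_cancel_inverse[OF PPi] mult_cancel_inverse[OF PiP]
    mult_cancel_inverse[OF QQi] mult_cancel_inverse[OF QiQ]
  have A_eq: "A = P * Qi"
    using A by (simp add: P_def mult_assoc_dim QQi)
  have At: "transpose_mat A = Qi * P" by (simp add: A_eq transpose_mult_dim tr)
  \<comment> \<open>Since \<open>A^-1 = Q Pi\<close>, these are \<open>K = C A^-1\<close> and
    \<open>M = A^-1 B\<close>. They are the outer factors in
    \<open>H = lower(K) diag(A, A^-T) upper(M)\<close>, where \<open>A^-T = Pi Q\<close>.\<close>
  define K where "K = C * (Q * Pi)"
  define M where "M = Q * Pi * B"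
  have Kc: "K \<in> carrier_mat d d" and Mc: "M \<in> carrier_mat d d"
    by (auto simp: K_def M_def intro!: carrier_matI)
  note [simp] = carrier_matD[OF Kc] carrier_matD[OF Mc]
  have AR: "A * (Q * Pi) = 1\<^sub>m d"
    by (simp add: A_eq mult_assoc_dim cancel PPi)
  note AC = symplectic_four_blockD(1)[OF A B C D sp]
    and AD = symplectic_four_blockD(2)[OF A B C D sp]
    and BD = symplectic_four_blockD(3)[OF A B C D sp]
  have K: "K \<in> symmetric_mats d"
    unfolding K_def by (rule symmetric_left_quotient[OF A C _ AR AC]) (auto intro: carrier_matI)
  have KA: "K * A = C"
    using C by (simp add: K_def A_eq mult_assoc_dim cancel QQi)
  have AM: "A * M = B"
    by (simp add: A_eq M_def mult_assoc_dim cancel)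
  \<comment> \<open>Multiply \<open>A^T D - C^T B = 1\<close> by \<open>A^-T = Pi Q\<close> from the
    left and use that \<open>K\<close> is symmetric.\<close>
  have D_eq: "K * B + Pi * Q = D"
  proof -
    have "Pi * (Q * (transpose_mat A * D - transpose_mat C * B)) = Pi * Q"
      unfolding AD using Qc by simp
    moreover have "Pi * (Q * (transpose_mat A * D - transpose_mat C * B)) =
        D - Pi * (Q * (transpose_mat C * B))"
      by (simp add: mult_minus_dim At mult_assoc_dim cancel)
    moreover have "Pi * (Q * (transpose_mat C * B)) = transpose_mat K * B"
      by (simp add: K_def transpose_mult_dim tr mult_assoc_dim)
    ultimately have "D - K * B = Pi * Q"
      by (simp add: symmetric_mats_transpose[OF K])
    then show ?thesis
      using D by (auto intro!: eq_matI simp flip: \<open>D - K * B = Pi * Q\<close>)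
  qed
  \<comment> \<open>Substituting \<open>D = K B + Pi Q\<close> into \<open>B^T D = D^T B\<close>,
    the common term \<open>B^T K B\<close> cancels and \<open>M^T = M\<close> remains.\<close>
  have M: "M \<in> symmetric_mats d"
  proof -
    have "transpose_mat B * D = transpose_mat B * (K * B) + transpose_mat M"
      by (simp flip: D_eq add: mult_add_dim M_def transpose_mult_dim tr mult_assoc_dim)
    moreover have "transpose_mat D * B = transpose_mat B * (K * B) + M"
      using symmetric_mats_transpose[OF K]
      by (simp flip: D_eq add: add_mult_dim transpose_add[of _ d d] carrier_matI M_def
          transpose_mult_dim tr mult_assoc_dim)
    ultimately have eq: "transpose_mat B * (K * B) + transpose_mat M = transpose_mat B * (K * B) + M"
      using BD by simp
    have "transpose_mat M = M"
    proof (rule eq_matI)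
      fix i j assume "i < dim_row M" "j < dim_col M"
      then show "transpose_mat M $$ (i, j) = M $$ (i, j)"
        using arg_cong[OF eq, of "\<lambda>Z. Z $$ (i, j)"] by simp
    qed auto
    then show ?thesis using Mc by (simp add: symmetric_mats_def)
  qed
  have c: "M - Q \<in> carrier_mat d d" "P - Q \<in> carrier_mat d d" "- Pi \<in> carrier_mat d d"
    "Qi * M \<in> carrier_mat d d" "P * Qi \<in> carrier_mat d d" "P * (Qi * M) - Q \<in> carrier_mat d d"
    "Pi * Q \<in> carrier_mat d d" "P * (Qi * M) \<in> carrier_mat d d"
    by (auto intro!: carrier_matI)
  \<comment> \<open>The product is evaluated from the right, one factor at a time. The factor with
    \<open>M - Q\<close> merges \<open>upper(- Q)\<close> with \<open>upper(M)\<close>, and the one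
    with \<open>P - Q\<close> merges \<open>upper(P)\<close> with \<open>upper(- Q)\<close>.\<close>
  have "lower_unit d Qi * upper_unit d (M - Q) =
      four_block_mat (1\<^sub>m d) (M - Q) Qi (Qi * M)"
  proof -
    have "Qi * (M - Q) + 1\<^sub>m d = Qi * M"
      by (simp add: mult_minus_dim QiQ) (rule eq_matI; simp)
    then show ?thesis
      unfolding upper_unit_def using c Qi by (simp add: lower_unit_mult)
  qed
  then have "upper_unit d (P - Q) * (lower_unit d Qi * upper_unit d (M - Q)) =
      four_block_mat (P * Qi) (P * (Qi * M) - Q) Qi (Qi * M)"
  proof -
    have "1\<^sub>m d + (P - Q) * Qi = P * Qi"
      by (simp add: minus_mult_dim QQi) (rule eq_matI; simp)
    moreover have "M - Q + (P - Q) * (Qi * M) = P * (Qi * M) - Q"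
      by (simp add: minus_mult_dim cancel) (rule eq_matI; simp)
    ultimately show ?thesis
      using \<open>lower_unit d Qi * _ = _\<close> c Qi by (simp add: upper_unit_mult)
  qed
  then have "lower_unit d (- Pi) * (upper_unit d (P - Q) * (lower_unit d Qi * upper_unit d (M - Q))) =
      four_block_mat (P * Qi) (P * (Qi * M) - Q) (0\<^sub>m d d) (Pi * Q)"
  proof -
    have "- Pi * (P * Qi) + Qi = 0\<^sub>m d d"
      using Qi by (simp add: cancel uminus_l_inv_mat)
    moreover have "- Pi * (P * (Qi * M) - Q) + Qi * M = Pi * Q"
      by (simp add: mult_minus_dim cancel) (rule eq_matI; simp)
    ultimately show ?thesis
      using \<open>upper_unit d (P - Q) * _ = _\<close> c Qi by (simp add: lower_unit_mult)
  qed
  then have "upper_unit d P * (lower_unit d (- Pi) * (upper_unit d (P - Q) *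
        (lower_unit d Qi * upper_unit d (M - Q)))) =
      four_block_mat A B (0\<^sub>m d d) (Pi * Q)"
  proof -
    have "P * (Qi * M) - Q + P * (Pi * Q) = B"
      unfolding AM[symmetric] A_eq by (simp add: cancel mult_assoc_dim) (rule eq_matI; simp)
    then show ?thesis
      using \<open>lower_unit d (- Pi) * _ = _\<close> c Pc A by (simp add: upper_unit_mult A_eq)
  qed
  then have "lower_unit d K * (upper_unit d P * (lower_unit d (- Pi) * (upper_unit d (P - Q) *
        (lower_unit d Qi * upper_unit d (M - Q))))) = four_block_mat A B C D"
    using A B C c Kc by (simp add: lower_unit_mult KA D_eq)
  then show ?thesis
    using K P Q M Pis Qis
    by (intro that[of "M - Q" Qi "P - Q" "- Pi" P K])
       (auto intro: symmetric_mats_minus symmetric_mats_uminus)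
qed

section \<open>Eight factors for a nonsingular upper left block\<close>

lemma L_set_8_eq:
  "L_set d 8 = {lower_unit d S8 * (upper_unit d S7 * (lower_unit d S6 * (upper_unit d S5 *
      (lower_unit d S4 * (upper_unit d S3 * (lower_unit d S2 * upper_unit d S1)))))) |
    S1 S2 S3 S4 S5 S6 S7 S8. {S1, S2, S3, S4, S5, S6, S7, S8} \<subseteq> symmetric_mats d}"
  (is "_ = ?R")
proof (intro equalityI subsetI)
  have one: "upper_unit d S * 1\<^sub>m (2 * d) = upper_unit d S" for S
    using upper_unit_carrier by (rule right_mult_one_mat)
  have product: "alternating_product d S 8 =
      lower_unit d (S 8) * (upper_unit d (S 7) * (lower_unit d (S 6) * (upper_unit d (S 5) *
      (lower_unit d (S 4) * (upper_unit d (S 3) * (lower_unit d (S 2) * upper_unit d (S 1)))))))"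
    for S
    using alternating_product.simps(2)[of d S 7] alternating_product.simps(2)[of d S 6]
      alternating_product.simps(2)[of d S 5] alternating_product.simps(2)[of d S 4]
      alternating_product.simps(2)[of d S 3] alternating_product.simps(2)[of d S 2]
      alternating_product.simps(2)[of d S 1] alternating_product.simps(2)[of d S 0]
    by (simp add: alternating_factor_def one flip: numeral_2_eq_2)
  fix X
  {
    assume "X \<in> L_set d 8"
    then obtain S where "X = alternating_product d S 8" "\<forall>i\<in>{1..8}. S i \<in> symmetric_mats d"
      by (auto simp: L_set_def)
    then show "X \<in> ?R" unfolding product by fastforce
  }
  assume "X \<in> ?R"
  then obtain S1 S2 S3 S4 S5 S6 S7 S8 where
    X: "X = lower_unit d S8 * (upper_unit d S7 * (lower_unit d S6 * (upper_unit d S5 *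
      (lower_unit d S4 * (upper_unit d S3 * (lower_unit d S2 * upper_unit d S1))))))"
    and S: "{S1, S2, S3, S4, S5, S6, S7, S8} \<subseteq> symmetric_mats d" by blast
  \<comment> \<open>Factors are numbered from 1 but list positions from 0; the first
    \<open>S1\<close> is a dummy at position 0, which the product never reads.\<close>
  define S where "S i = [S1, S1, S2, S3, S4, S5, S6, S7, S8] ! i" for i
  have "X = alternating_product d S 8"
    unfolding product by (simp add: X S_def)
  moreover have "\<forall>i\<in>{1..8}. S i \<in> symmetric_mats d"
  proof
    fix i :: nat assume "i \<in> {1..8}"
    then have "S i \<in> set [S1, S1, S2, S3, S4, S5, S6, S7, S8]"
      unfolding S_def by (intro nth_mem) simp
    then show "S i \<in> symmetric_mats d" using S by auto
  qed
  ultimately show "X \<in> L_set d 8" by (auto simp: L_set_def)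
qed

lemma left_upper_block_four_block:
  assumes "A \<in> carrier_mat d d" "D \<in> carrier_mat d d"
  shows "left_upper_block d (four_block_mat A B C D) = A"
  using assms by (auto simp: left_upper_block_def intro!: eq_matI)

lemma invertible_mat_det_nonzero:
  fixes A :: "'a :: field mat"
  assumes A: "A \<in> carrier_mat n n" and inv: "invertible_mat A"
  shows "det A \<noteq> 0"
proof -
  obtain B where B: "A * B = 1\<^sub>m n" "B * A = 1\<^sub>m (dim_row B)"
    using A inv by (auto simp: invertible_mat_def inverts_mat_def)
  \<comment> \<open>\<open>invertible_mat\<close> does not state the dimensions of \<open>B\<close>;
    they follow by comparing column counts in the two products.\<close>
  have "B \<in> carrier_mat n n"
    using A arg_cong[OF B(1), of dim_col] arg_cong[OF B(2), of dim_col] by (auto intro: carrier_matI)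
  then show ?thesis using inverse_det_nonzero[OF A _ B(1)] by simp
qed

text \<open>Two factors applied to \<open>H\<close> change the upper left block to
  \<open>G A\<close>, six factors produce the result, and the inverses of the first two complete the
  eight.\<close>

lemma SPN_subset_L_set: "SPN d \<subseteq> L_set d 8"
proof
  fix H assume "H \<in> SPN d"
  then have spH: "symplectic d H" and inv: "invertible_mat (left_upper_block d H)"
    by (auto simp: SPN_def)
  then have Hc: "H \<in> carrier_mat (2 * d) (2 * d)" by (simp add: symplectic_def)
  obtain A B C D where "split_block H d d = (A, B, C, D)" by (metis prod_cases4)
  from split_block[OF this, of d d] Hc
  have A: "A \<in> carrier_mat d d" and B: "B \<in> carrier_mat d d" and C: "C \<in> carrier_mat d d"
    and D: "D \<in> carrier_mat d d" and H: "H = four_block_mat A B C D" by (auto simp: mult_2)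
  have dA: "det A \<noteq> 0"
    using inv A D by (intro invertible_mat_det_nonzero[OF A]) (simp add: H left_upper_block_four_block)
  obtain R where R: "R \<in> carrier_mat d d" and AR: "A * R = 1\<^sub>m d" and RA: "R * A = 1\<^sub>m d"
    using det_nonzero_inverse[OF A dA] .
  obtain G where G: "symmetrizable d G" "det G \<noteq> 0" and GA: "symmetrizable d (G * A)"
    using nonsingular_symmetrizable_quotient[OF A dA] by (auto simp: symmetrizable_quotient_def)
  then obtain Q where Gc: "G \<in> carrier_mat d d" and Q: "Q \<in> symmetric_mats d" "det Q \<noteq> 0"
    and GQ: "G * Q \<in> symmetric_mats d" by (auto simp: symmetrizable_def)
  have Qc: "Q \<in> carrier_mat d d" using Q(1) by (rule symmetric_mats_carrier)
  obtain T where T: "T \<in> carrier_mat d d" and QT: "Q * T = 1\<^sub>m d" and TQ: "T * Q = 1\<^sub>m d"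
    using det_nonzero_inverse[OF Qc Q(2)] .
  note [simp] = carrier_matD[OF A] carrier_matD[OF B] carrier_matD[OF C] carrier_matD[OF D]
    carrier_matD[OF Gc] carrier_matD[OF Qc] carrier_matD[OF T] carrier_matD[OF R]
  have "C * R \<in> symmetric_mats d"
    by (rule symmetric_left_quotient[OF A C R AR symplectic_four_blockD(1)[OF A B C D spH[unfolded H]]])
  \<comment> \<open>With \<open>T = Q^-1\<close> one has \<open>S T = G - 1\<close>. The factor with
    \<open>K = T - C A^-1\<close> changes the lower left block from \<open>C\<close> to
    \<open>T A\<close>, and the factor with \<open>S\<close> then adds
    \<open>S T A = G A - A\<close> to \<open>A\<close>.\<close>
  define S where "S = G * Q - Q"
  define K where "K = T - C * R"
  have S: "S \<in> symmetric_mats d"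
    using GQ Q(1) by (simp add: S_def symmetric_mats_minus)
  have K: "K \<in> symmetric_mats d"
    using symmetric_mats_inverse[OF Q(1) T QT TQ] \<open>C * R \<in> symmetric_mats d\<close>
    by (simp add: K_def symmetric_mats_minus)
  note Sc = symmetric_mats_carrier[OF S] and Kc = symmetric_mats_carrier[OF K]
  note [simp] = carrier_matD[OF Sc] carrier_matD[OF Kc]
  have "K * A + C = T * A"
    using C by (simp add: K_def minus_mult_dim mult_assoc_dim RA) (rule eq_matI; simp)
  then have "lower_unit d K * H = four_block_mat A B (T * A) (K * B + D)"
    unfolding H using A B C D Kc by (simp add: lower_unit_mult)
  moreover have "A + S * (T * A) = G * A"
  proof -
    have "S * (T * A) = G * A - A"
      by (simp add: S_def minus_mult_dim mult_assoc_dim mult_cancel_inverse[OF QT])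
    then show ?thesis by (intro eq_matI) auto
  qed
  ultimately have H': "upper_unit d S * (lower_unit d K * H) =
      four_block_mat (G * A) (B + S * (K * B + D)) (T * A) (K * B + D)"
    using A B D Sc by (simp add: upper_unit_mult carrier_matI)
  have sp: "symplectic d (upper_unit d S * (lower_unit d K * H))"
    by (intro symplectic_mult symplectic_upper_unit symplectic_lower_unit S K spH)
  have dGA: "det (G * A) \<noteq> 0" using G(2) dA by (simp add: det_mult[OF Gc A])
  have c: "G * A \<in> carrier_mat d d" "B + S * (K * B + D) \<in> carrier_mat d d"
    "T * A \<in> carrier_mat d d" "K * B + D \<in> carrier_mat d d"
    by (auto intro!: carrier_matI)
  obtain S1 S2 S3 S4 S5 S6 where six: "{S1, S2, S3, S4, S5, S6} \<subseteq> symmetric_mats d"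
    "upper_unit d S * (lower_unit d K * H) = lower_unit d S6 * (upper_unit d S5 * (lower_unit d S4 *
       (upper_unit d S3 * (lower_unit d S2 * upper_unit d S1))))"
    unfolding H' using symplectic_six_factors[OF c sp[unfolded H'] GA dGA] .
  \<comment> \<open>The six-factor product starts with a lower factor on the left, so these two
    inverses continue the alternation without merging.\<close>
  have "H = lower_unit d (- K) * (upper_unit d (- S) * (upper_unit d S * (lower_unit d K * H)))"
    using upper_unit_cancel[OF Sc, of "lower_unit d K * H"] lower_unit_cancel[OF Kc Hc]
      mult_carrier_mat[OF lower_unit_carrier Hc] by simp
  then have "H = lower_unit d (- K) * (upper_unit d (- S) * (lower_unit d S6 * (upper_unit d S5 *
      (lower_unit d S4 * (upper_unit d S3 * (lower_unit d S2 * upper_unit d S1))))))"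
    unfolding six(2) .
  moreover have "{S1, S2, S3, S4, S5, S6, - S, - K} \<subseteq> symmetric_mats d"
    using six(1) S K by (simp add: symmetric_mats_uminus)
  ultimately show "H \<in> L_set d 8" unfolding L_set_8_eq by blast
qed

section \<open>Properness of the inclusion and the factorization as a list\<close>

text \<open>\<open>J = upper(1) lower(- 1) upper(1)\<close>; factors with the zero matrix are
  identities and pad the product to length eight.\<close>

lemma symplectic_form_in_L_set: "symplectic_form d \<in> L_set d 8"
proof -
  let ?O = "0\<^sub>m d d"
  have zero: "lower_unit d ?O = 1\<^sub>m (2 * d)" "upper_unit d ?O = 1\<^sub>m (2 * d)"
    by (simp_all add: lower_unit_def upper_unit_def mult_2)
  have sum: "1\<^sub>m d + - 1\<^sub>m d = (?O :: real mat)" "- 1\<^sub>m d + 1\<^sub>m d = (?O :: real mat)"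
    by (intro eq_matI; simp)+
  have "lower_unit d (- 1\<^sub>m d) * upper_unit d (1\<^sub>m d) = four_block_mat (1\<^sub>m d) (1\<^sub>m d) (- 1\<^sub>m d) ?O"
    unfolding upper_unit_def by (simp add: lower_unit_mult sum)
  then have "upper_unit d (1\<^sub>m d) * (lower_unit d (- 1\<^sub>m d) * upper_unit d (1\<^sub>m d)) = symplectic_form d"
    by (simp add: upper_unit_mult symplectic_form_def sum)
  then have "symplectic_form d = lower_unit d ?O * (upper_unit d ?O * (lower_unit d ?O * (upper_unit d ?O *
      (lower_unit d ?O * (upper_unit d (1\<^sub>m d) * (lower_unit d (- 1\<^sub>m d) * upper_unit d (1\<^sub>m d)))))))"
    unfolding zero by (simp add: left_mult_one_mat[OF symplectic_form_carrier])
  moreover have "{1\<^sub>m d, - 1\<^sub>m d, ?O} \<subseteq> symmetric_mats d"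
    by (auto simp: symmetric_mats_def transpose_uminus)
  ultimately show ?thesis unfolding L_set_8_eq by blast
qed

text \<open>The upper left block of \<open>J\<close> is zero. For \<open>d = 0\<close> this empty
  block would have determinant 1, so \<open>d \<ge> 1\<close> matters.\<close>

lemma symplectic_form_notin_SPN:
  assumes "d \<ge> 1"
  shows "symplectic_form d \<notin> SPN d"
proof
  assume "symplectic_form d \<in> SPN d"
  then have "det (0\<^sub>m d d :: real mat) \<noteq> 0"
    by (intro invertible_mat_det_nonzero) (auto simp: SPN_def symplectic_form_def left_upper_block_four_block)
  then show False using assms by simp
qed

lemma L_set_product_list:
  assumes "H \<in> L_set d n"
  shows "\<exists>Ms. length Ms = n \<and> set Ms \<subseteq> unit_triangular_symplectic d \<and>
    H = foldr (*) Ms (1\<^sub>m (2 * d))"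
proof -
  obtain S where H: "H = alternating_product d S n" and S: "\<forall>i\<in>{1..n}. S i \<in> symmetric_mats d"
    using assms by (auto simp: L_set_def)
  \<comment> \<open>The list is reversed because \<open>foldr\<close> puts its head leftmost, where
    the last factor belongs.\<close>
  have "alternating_product d S k = foldr (*) (rev (map (alternating_factor d S) [1..<Suc k])) (1\<^sub>m (2 * d))"
    for k by (induction k) simp_all
  moreover have "alternating_factor d S i \<in> unit_triangular_symplectic d" if "i \<in> {1..n}" for i
    using S that by (auto simp: alternating_factor_def unit_triangular_symplectic_def)
  ultimately show ?thesis
    by (intro exI[of _ "rev (map (alternating_factor d S) [1..<Suc n])"]) (auto simp: H)
qed

theorem theorem8:
  fixes d :: nat
  assumes "d \<ge> 1"
  shows "SPN d \<subset> L_set d 8 \<and>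
    (\<forall>H\<in>SPN d. \<exists>Ms. length Ms \<le> 8 \<and> set Ms \<subseteq> unit_triangular_symplectic d \<and>
       H = foldr (*) Ms (1\<^sub>m (2 * d)))"
proof
  show "SPN d \<subset> L_set d 8"
    using SPN_subset_L_set symplectic_form_in_L_set symplectic_form_notin_SPN[OF assms] by blast
  show "\<forall>H\<in>SPN d. \<exists>Ms. length Ms \<le> 8 \<and> set Ms \<subseteq> unit_triangular_symplectic d \<and>
       H = foldr (*) Ms (1\<^sub>m (2 * d))"
    using L_set_product_list[of _ d 8] SPN_subset_L_set by (metis order_refl subsetD)
qed

end
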